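(* Let $n\ge3$. Start from $\varphi_0=\textsf{AtMostOne}(x_1,\dots,x_n)$ and repeatedly apply the following heuristic BVA procedure to the current formula $\varphi$ until it stops: for each variable $v$ of $\varphi$ let $N(v)$ be the set of literals $\ell$ such that $(\overline{v}\lor\ell)\in\varphi$; choose a variable $v$ with $|N(v)|$ maximum (any such $v$); set $L=\{v\}$, $R=N(v)$, $Q=|L||R|-|L|-|R|$; then repeat: iterate over the variables $w\notin L$ in some order, computing $R_w=R\cap N(w)$ and $Q_w=(|L|+1)|R_w|-(|L|+1)-|R_w|$, and keep as candidate the first $w$ (in that order) whose $Q_w$ strictly exceeds the best value seen so far (initially $Q$); if no candidate exists, exit this loop; otherwise add the candidate $w$ to $L$ and set $R:=R_w$, $Q:=Q_w$. After the loop, if $Q>0$, perform the BVA step with $\mathcal{C}=\{(\overline{v}):v\in L\}$ and $\mathcal{D}=\{(\ell):\ell\in R\}$ (replacing the clauses $(\overline{v}\lor\ell)$, $v\in L,\ell\in R$, by $(\overline{v}\lor y)$, $v\in L$, and $(\overline{y}\lor\ell)$, $\ell\in R$, for a fresh variable $y$) and continue; if $Q\le0$, stop. Then, for every possible resolution of the choices (the choice of $v$ and the iteration orders), the final formula has exactly $3n-6$ clauses.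
   Context: A literal is a variable $x$ or its negation $\overline{x}$; a clause is a set of non-complementary literals; a formula is a set of clauses, and its size is its number of clauses. $\textsf{AtMostOne}(x_1,\dots,x_n):=\bigwedge_{1\le i<j\le n}(\overline{x_i}\lor\overline{x_j})$. A BVA step on $\varphi$: given sets $\mathcal{C},\mathcal{D}$ of nonempty clauses with $\{C\cup D: C\in\mathcal{C},D\in\mathcal{D}\}\subseteq\varphi$ and a fresh variable $y$, replace these clauses $C\cup D$ by the clauses $C\cup\{y\}$ ($C\in\mathcal{C}$) and $\{\overline{y}\}\cup D$ ($D\in\mathcal{D}$). *)

theory Defs
  imports Main
begin

datatype 'v literal = Pos 'v | Neg 'v

type_synonym 'v clause = "'v literal set"
type_synonym 'v formula = "'v clause set"

fun var :: "'v literal \<Rightarrow> 'v" where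
  "var (Pos v) = v"
| "var (Neg v) = v"

definition vars :: "'v formula \<Rightarrow> 'v set" where
  "vars \<phi> = (\<Union>c\<in>\<phi>. var ` c)"

definition non_complementary :: "'v clause \<Rightarrow> bool" where
  "non_complementary c \<longleftrightarrow> (\<nexists>v. Pos v \<in> c \<and> Neg v \<in> c)"

definition at_most_one :: "nat \<Rightarrow> (nat \<Rightarrow> 'v) \<Rightarrow> 'v formula" where
  "at_most_one n x = {{Neg (x i), Neg (x j)} | i j. 1 \<le> i \<and> i < j \<and> j \<le> n}"

definition clause_products :: "'v clause set \<Rightarrow> 'v clause set \<Rightarrow> 'v formula" where
  "clause_products \<C> \<D> = {C \<union> D | C D. C \<in> \<C> \<and> D \<in> \<D>}"

definition bva_step ::
  "'v clause set \<Rightarrow> 'v clause set \<Rightarrow> 'v \<Rightarrow> 'v formula \<Rightarrow> 'v formula \<Rightarrow> bool" where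
  "bva_step \<C> \<D> y \<phi> \<psi> \<longleftrightarrow>
     (\<forall>C \<in> \<C> \<union> \<D>. non_complementary C \<and> C \<noteq> {}) \<and>
     clause_products \<C> \<D> \<subseteq> \<phi> \<and>
     y \<notin> vars (\<phi> \<union> \<C> \<union> \<D>) \<and>
     \<psi> = (\<phi> - clause_products \<C> \<D>)
         \<union> {C \<union> {Pos y} | C. C \<in> \<C>} \<union> {{Neg y} \<union> D | D. D \<in> \<D>}"

definition nbrs :: "'v formula \<Rightarrow> 'v \<Rightarrow> 'v literal set" where
  "nbrs \<phi> v = {l. {Neg v, l} \<in> \<phi>}"

definition gain :: "nat \<Rightarrow> nat \<Rightarrow> int" where
  "gain a b = int a * int b - int a - int b"

text \<open>One pass over the variables in the given order: \<open>best\<close> is the best value seen so far and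
  \<open>cand\<close> the current candidate.  The result is the first variable of maximal value, provided
  that value exceeds the initial \<open>best\<close>.\<close>

fun scan :: "('v \<Rightarrow> int) \<Rightarrow> int \<Rightarrow> 'v option \<Rightarrow> 'v list \<Rightarrow> 'v option" where
  "scan q best cand [] = cand"
| "scan q best cand (w # ws) =
     (if q w > best then scan q (q w) (Some w) ws else scan q best cand ws)"

definition scan_result ::
  "'v formula \<Rightarrow> 'v set \<Rightarrow> 'v literal set \<Rightarrow> int \<Rightarrow> 'v list \<Rightarrow> 'v option" where
  "scan_result \<phi> L R Q ws =
     scan (\<lambda>w. gain (card L + 1) (card (R \<inter> nbrs \<phi> w))) Q None ws"

definition iteration_order :: "'v formula \<Rightarrow> 'v set \<Rightarrow> 'v list \<Rightarrow> bool" where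
  "iteration_order \<phi> L ws \<longleftrightarrow> distinct ws \<and> set ws = vars \<phi> - L"

text \<open>Control states of the procedure: about to choose \<open>v\<close> in the current formula; inside the
  loop with current \<open>L\<close>, \<open>R\<close>, \<open>Q\<close>; stopped with a final formula.  The nondeterminism of the
  transition relation is exactly the choice of \<open>v\<close>, of the iteration order (anew for every pass)
  and of the name of the fresh variable.\<close>

datatype 'v state =
    Choose "'v formula"
  | Loop "'v formula" "'v set" "'v literal set" int
  | Final "'v formula"

inductive heuristic_step :: "'v state \<Rightarrow> 'v state \<Rightarrow> bool" where
  choose:
    "v \<in> vars \<phi> \<Longrightarrow> (\<forall>u \<in> vars \<phi>. card (nbrs \<phi> u) \<le> card (nbrs \<phi> v)) \<Longrightarrow>
     L = {v} \<Longrightarrow> R = nbrs \<phi> v \<Longrightarrow>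
     heuristic_step (Choose \<phi>) (Loop \<phi> L R (gain (card L) (card R)))"
| extend:
    "iteration_order \<phi> L ws \<Longrightarrow> scan_result \<phi> L R Q ws = Some w \<Longrightarrow> R\<^sub>w = R \<inter> nbrs \<phi> w \<Longrightarrow>
     heuristic_step (Loop \<phi> L R Q) (Loop \<phi> (insert w L) R\<^sub>w (gain (card L + 1) (card R\<^sub>w)))"
| replace:
    "iteration_order \<phi> L ws \<Longrightarrow> scan_result \<phi> L R Q ws = None \<Longrightarrow> Q > 0 \<Longrightarrow>
     bva_step {{Neg v} | v. v \<in> L} {{l} | l. l \<in> R} y \<phi> \<psi> \<Longrightarrow>
     heuristic_step (Loop \<phi> L R Q) (Choose \<psi>)"
| stop:
    "iteration_order \<phi> L ws \<Longrightarrow> scan_result \<phi> L R Q ws = None \<Longrightarrow> Q \<le> 0 \<Longrightarrow>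
     heuristic_step (Loop \<phi> L R Q) (Final \<phi>)"

end

theory Submission
  imports Defs "HOL-Library.Disjoint_Sets"
begin

text \<open>The current formula is always a union of at-most-one constraints over pairwise disjoint sets
  of literals, which we call blocks, each of size at least 3 and with at most one positive literal.
  The heuristic picks a largest block \<open>K\<close>, and its gain \<open>l (k - l) - k\<close> with \<open>k = |K|\<close>, \<open>l = |L|\<close>
  grows exactly until \<open>L\<close> is half of \<open>K\<close>. The replacement splits \<open>K\<close> into blocks of sizes \<open>l + 1\<close> and
  \<open>k - l + 1\<close>, so the sum of \<open>|K| - 2\<close> over all blocks keeps its initial value \<open>n - 2\<close>. A balanced
  split has positive gain iff \<open>k \<ge> 5\<close>, so at the end all blocks have size 3 or 4; these have
  3 and 6 clauses, that is \<open>3 (|K| - 2)\<close> in both cases.\<close>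

section \<open>Blocks and the invariant\<close>

definition clique :: "'v literal set \<Rightarrow> 'v formula" where
  "clique K = {c. c \<subseteq> K \<and> card c = 2}"

text \<open>Only negated variables can help to enlarge \<open>L\<close>. With at most one positive
  literal per block, candidates do not run out before the block is cut in half. Size at least 3 then
  gives each block a negative literal and makes the truncated subtraction in \<open>excess\<close>
  exact.\<close>

definition blocks :: "'v literal set set \<Rightarrow> 'v formula \<Rightarrow> bool" where
  "blocks \<K> \<phi> \<longleftrightarrow> finite \<K> \<and> \<K> \<noteq> {} \<and> disjoint \<K> \<and> \<phi> = (\<Union>K\<in>\<K>. clique K) \<and>
     (\<forall>K\<in>\<K>. finite K \<and> 3 \<le> card K \<and> (\<forall>u v. Pos u \<in> K \<longrightarrow> Pos v \<in> K \<longrightarrow> u = v))"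

definition excess :: "'v literal set set \<Rightarrow> nat" where
  "excess \<K> = (\<Sum>K\<in>\<K>. card K - 2)"

text \<open>The negations of \<open>L\<close> and the set \<open>R\<close> are the two sides of a
  cut of \<open>K\<close>. Maximality of \<open>K\<close> carries a size bound for \<open>K\<close>
  over to all blocks; the bound by half keeps the side of \<open>L\<close> from becoming the larger
  one.\<close>

definition loop_block ::
  "'v literal set set \<Rightarrow> 'v literal set \<Rightarrow> 'v set \<Rightarrow> 'v literal set \<Rightarrow> int \<Rightarrow> bool" where
  "loop_block \<K> K L R Q \<longleftrightarrow> K \<in> \<K> \<and> (\<forall>K'\<in>\<K>. card K' \<le> card K) \<and>
     L \<noteq> {} \<and> Neg ` L \<subseteq> K \<and> R = K - Neg ` L \<and> 2 * card L \<le> card K \<and>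
     Q = gain (card L) (card R)"

fun state_inv :: "nat \<Rightarrow> 'v state \<Rightarrow> bool" where
  "state_inv m (Choose \<phi>) \<longleftrightarrow> (\<exists>\<K>. blocks \<K> \<phi> \<and> excess \<K> = m)"
| "state_inv m (Loop \<phi> L R Q) \<longleftrightarrow>
     (\<exists>\<K> K. blocks \<K> \<phi> \<and> excess \<K> = m \<and> loop_block \<K> K L R Q)"
| "state_inv m (Final \<phi>) \<longleftrightarrow> card \<phi> = 3 * m"

section \<open>Pairs within a set of literals\<close>

lemma pair_in_clique_iff: "{a, b} \<in> clique K \<longleftrightarrow> a \<in> K \<and> b \<in> K \<and> a \<noteq> b"
  by (auto simp: clique_def card_insert_if)

lemma in_clique_iff: "c \<in> clique K \<longleftrightarrow> (\<exists>a b. c = {a, b} \<and> a \<in> K \<and> b \<in> K \<and> a \<noteq> b)"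
  unfolding clique_def card_2_iff by blast

lemma finite_clique: "finite K \<Longrightarrow> finite (clique K)"
  by (simp add: clique_def)

lemma card_clique: "finite K \<Longrightarrow> card (clique K) = card K choose 2"
  by (simp add: clique_def n_subsets)

text \<open>Meant for a fresh literal \<open>a\<close>: the clauses added on one side of a
  replacement enlarge the clique on that side by one literal.\<close>

lemma clique_insert:
  assumes "a \<notin> K"
  shows "clique (insert a K) = clique K \<union> {{a, b} | b. b \<in> K}"
proof (intro set_eqI iffI)
  fix c assume "c \<in> clique (insert a K)"
  then obtain p q where "c = {p, q}" "p \<in> insert a K" "q \<in> insert a K" "p \<noteq> q"
    by (auto simp: in_clique_iff)
  then show "c \<in> clique K \<union> {{a, b} | b. b \<in> K}"
    by (auto simp: pair_in_clique_iff doubleton_eq_iff)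
next
  fix c assume "c \<in> clique K \<union> {{a, b} | b. b \<in> K}"
  then show "c \<in> clique (insert a K)"
    using assms by (auto simp: in_clique_iff)
qed

lemma clique_disjoint:
  assumes "K \<inter> K' = {}"
  shows "clique K \<inter> clique K' = {}"
proof -
  have "card c \<noteq> 2" if "c \<subseteq> K" "c \<subseteq> K'" for c
  proof -
    have "c = {}" using that assms by blast
    then show ?thesis by simp
  qed
  then show ?thesis by (auto simp: clique_def)
qed

text \<open>Deleting the pairs across a cut is what the replacement does to the clauses of the
  chosen block.\<close>

lemma clique_Un:
  assumes "A \<inter> B = {}"
  shows "clique (A \<union> B) - {{a, b} | a b. a \<in> A \<and> b \<in> B} = clique A \<union> clique B"
proof (intro set_eqI iffI)
  fix c assume c: "c \<in> clique (A \<union> B) - {{a, b} | a b. a \<in> A \<and> b \<in> B}"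
  then obtain p q where "c = {p, q}" "p \<in> A \<union> B" "q \<in> A \<union> B" "p \<noteq> q"
    by (auto simp: in_clique_iff)
  moreover from this c have "\<not> (p \<in> A \<and> q \<in> B)" "\<not> (q \<in> A \<and> p \<in> B)"
    by (blast, (auto simp: insert_commute)[])
  ultimately show "c \<in> clique A \<union> clique B"
    by (auto simp: pair_in_clique_iff)
next
  fix c assume "c \<in> clique A \<union> clique B"
  then show "c \<in> clique (A \<union> B) - {{a, b} | a b. a \<in> A \<and> b \<in> B}"
    using assms by (fastforce simp: in_clique_iff doubleton_eq_iff)
qed

lemma cut_subset_clique:
  "A \<subseteq> K \<Longrightarrow> {{a, b} | a b. a \<in> A \<and> b \<in> K - A} \<subseteq> clique K"
  by (auto simp: pair_in_clique_iff)

lemma at_most_one_eq_clique: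
  assumes "inj_on x {1..n}"
  shows "at_most_one n x = clique (Neg ` x ` {1..n})"
proof (intro set_eqI iffI)
  fix c assume "c \<in> at_most_one n x"
  then obtain i j where "c = {Neg (x i), Neg (x j)}" "1 \<le> i" "i < j" "j \<le> n"
    by (auto simp: at_most_one_def)
  \<comment> \<open>Otherwise the clause would collapse to a singleton, which no clique
    contains.\<close>
  moreover from this have "x i \<noteq> x j"
    using inj_onD[OF assms, of i j] by auto
  ultimately show "c \<in> clique (Neg ` x ` {1..n})"
    by (auto simp: pair_in_clique_iff)
next
  fix c assume "c \<in> clique (Neg ` x ` {1..n})"
  then obtain i j where "c = {Neg (x i), Neg (x j)}" "i \<in> {1..n}" "j \<in> {1..n}"
      "Neg (x i) \<noteq> Neg (x j)"
    unfolding in_clique_iff by blast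
  then have c: "c = {Neg (x i), Neg (x j)}" "i \<in> {1..n}" "j \<in> {1..n}" "i \<noteq> j"
    by auto
  show "c \<in> at_most_one n x"
  proof (cases "i < j")
    case True
    with c show ?thesis by (auto simp: at_most_one_def)
  next
    case False
    with c have "c = {Neg (x j), Neg (x i)}" "1 \<le> j" "j < i" "i \<le> n" by auto
    then show ?thesis unfolding at_most_one_def by blast
  qed
qed

section \<open>Formulas made of blocks\<close>

lemma blocks_at_most_one:
  assumes "n \<ge> 3" and "inj_on x {1..n}"
  shows "blocks {Neg ` x ` {1..n}} (at_most_one n x)"
    and "excess {Neg ` x ` {1..n}} = n - 2"
proof -
  have "card (Neg ` x ` {1..n}) = n"
    using card_image[OF assms(2)] by (subst card_image) (auto intro: inj_onI)
  then show "blocks {Neg ` x ` {1..n}} (at_most_one n x)" "excess {Neg ` x ` {1..n}} = n - 2"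
    using assms by (auto simp: blocks_def excess_def at_most_one_eq_clique)
qed

lemma blocks_unique:
  assumes "blocks \<K> \<phi>" "K \<in> \<K>" "K' \<in> \<K>" "a \<in> K" "a \<in> K'"
  shows "K = K'"
proof (rule ccontr)
  assume "K \<noteq> K'"
  moreover have "disjoint \<K>" using assms(1) by (simp add: blocks_def)
  ultimately have "K \<inter> K' = {}" using assms(2,3) by (intro disjointD)
  then show False using assms(4,5) by blast
qed

lemma in_nbrs_iff:
  assumes "blocks \<K> \<phi>"
  shows "l \<in> nbrs \<phi> v \<longleftrightarrow> (\<exists>K\<in>\<K>. Neg v \<in> K \<and> l \<in> K \<and> l \<noteq> Neg v)"
proof -
  have "\<phi> = (\<Union>K\<in>\<K>. clique K)" using assms by (simp add: blocks_def)
  then show ?thesis by (auto simp: nbrs_def pair_in_clique_iff)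
qed

text \<open>Disjointness puts \<open>Neg v\<close> into a single block. Another block may contain
  \<open>Pos v\<close>, but \<open>nbrs\<close> sees only clauses with \<open>Neg v\<close>.\<close>

lemma nbrs_eq:
  assumes "blocks \<K> \<phi>" "K \<in> \<K>" "Neg v \<in> K"
  shows "nbrs \<phi> v = K - {Neg v}"
proof (intro set_eqI iffI)
  fix l assume "l \<in> nbrs \<phi> v"
  then obtain K' where "K' \<in> \<K>" "Neg v \<in> K'" "l \<in> K'" "l \<noteq> Neg v"
    by (auto simp: in_nbrs_iff[OF assms(1)])
  then show "l \<in> K - {Neg v}"
    using blocks_unique[OF assms(1), of K' K "Neg v"] assms(2,3) by simp
next
  fix l assume "l \<in> K - {Neg v}"
  then show "l \<in> nbrs \<phi> v"
    using assms(2,3) by (auto simp: in_nbrs_iff[OF assms(1)])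
qed

lemma finite_blocks:
  assumes "blocks \<K> \<phi>"
  shows "finite \<phi>" and "finite (vars \<phi>)"
proof -
  show "finite \<phi>"
    using assms by (auto simp: blocks_def finite_clique)
  moreover have "finite c" if "c \<in> \<phi>" for c
    using that assms by (auto simp: blocks_def in_clique_iff)
  ultimately show "finite (vars \<phi>)"
    by (auto simp: vars_def)
qed

lemma vars_blocks:
  assumes "blocks \<K> \<phi>"
  shows "vars \<phi> = (\<Union>K\<in>\<K>. var ` K)"
proof -
  have "\<exists>c\<in>clique K. a \<in> c" if "K \<in> \<K>" "a \<in> K" for K a
  proof -
    have "\<not> K \<subseteq> {a}"
      using that assms card_mono[of "{a}" K] by (auto simp: blocks_def)
    then obtain b where "b \<in> K" "b \<noteq> a" by auto
    then have "{a, b} \<in> clique K" using that by (auto simp: pair_in_clique_iff)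
    then show ?thesis by blast
  qed
  then have "\<Union> (clique K) = K" if "K \<in> \<K>" for K
    using that by (auto simp: clique_def)
  moreover have "vars \<phi> = (\<Union>K\<in>\<K>. var ` \<Union> (clique K))"
    using assms unfolding vars_def blocks_def by blast
  ultimately show ?thesis by simp
qed

text \<open>The negations of \<open>L\<close> and the at most one positive literal cannot exhaust
  \<open>card L + 2\<close> literals. With \<open>L\<close> empty this makes each block visible to
  the choice of \<open>v\<close>; inside the loop it supplies a candidate.\<close>

lemma block_has_Neg:
  assumes "blocks \<K> \<phi>" "K \<in> \<K>" "Neg ` L \<subseteq> K" "card L + 2 \<le> card K"
  shows "\<exists>w. w \<notin> L \<and> Neg w \<in> K"
proof (rule ccontr)
  assume none: "\<nexists>w. w \<notin> L \<and> Neg w \<in> K"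
  have fin: "finite K" and one: "\<And>u v. Pos u \<in> K \<Longrightarrow> Pos v \<in> K \<Longrightarrow> u = v"
    using assms(1,2) by (auto simp: blocks_def)
  have "finite (Neg ` L)" using assms(3) fin by (rule finite_subset)
  then have finL: "finite L" by (rule finite_imageD) (simp add: inj_on_def)
  \<comment> \<open>If \<open>K\<close> has no positive literal, any \<open>u\<close> will
    do.\<close>
  obtain u where u: "\<And>v. Pos v \<in> K \<Longrightarrow> v = u"
    using one by (cases "\<exists>u. Pos u \<in> K") blast+
  have "K \<subseteq> insert (Pos u) (Neg ` L)"
  proof
    fix l assume "l \<in> K"
    then show "l \<in> insert (Pos u) (Neg ` L)"
      using u none by (cases l) auto
  qed
  then have "card K \<le> card (insert (Pos u) (Neg ` L))"
    using finL by (intro card_mono) auto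
  also have "\<dots> = Suc (card L)"
    using finL by (subst card_insert_disjoint) (auto simp: card_image inj_on_def)
  finally show False using assms(4) by simp
qed

lemma card_blocks:
  assumes "blocks \<K> \<phi>"
  shows "card \<phi> = (\<Sum>K\<in>\<K>. card K choose 2)"
proof -
  have "card \<phi> = card (\<Union> (clique ` \<K>))"
    using assms by (simp add: blocks_def)
  also have "\<dots> = (\<Sum>K\<in>\<K>. card (clique K))"
  proof (intro card_UN_disjoint ballI impI)
    show "clique K \<inter> clique K' = {}" if "K \<in> \<K>" "K' \<in> \<K>" "K \<noteq> K'" for K K'
      using that blocks_unique[OF assms] by (intro clique_disjoint) blast
  qed (use assms in \<open>auto simp: blocks_def finite_clique\<close>)
  also have "\<dots> = (\<Sum>K\<in>\<K>. card K choose 2)"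
    using assms by (intro sum.cong) (auto simp: blocks_def card_clique)
  finally show ?thesis .
qed

section \<open>The loop inside a largest block\<close>

lemma loop_block_cards:
  assumes "blocks \<K> \<phi>" "loop_block \<K> K L R Q"
  shows "finite L" "1 \<le> card L" "finite K" "3 \<le> card K" "card L + card R = card K"
    "card L \<le> card R" "Q = (int (card L) - 1) * (int (card R) - 1) - 1"
proof -
  have K: "K \<in> \<K>" "L \<noteq> {}" "Neg ` L \<subseteq> K" "R = K - Neg ` L" "2 * card L \<le> card K"
    "Q = gain (card L) (card R)"
    using assms(2) by (auto simp: loop_block_def)
  show "finite K" "3 \<le> card K" using assms(1) K(1) by (auto simp: blocks_def)
  then have "finite (Neg ` L)" using K(3) finite_subset by blast
  then show "finite L" by (rule finite_imageD) (simp add: inj_on_def)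
  then show "1 \<le> card L" using K(2) by (simp add: Suc_le_eq card_gt_0_iff)
  have "card (Neg ` L) = card L" by (simp add: card_image inj_on_def)
  then show 1: "card L + card R = card K"
    using K(3,4) \<open>finite K\<close> \<open>finite (Neg ` L)\<close>
    by (metis card_Diff_subset card_mono le_add_diff_inverse)
  then show "card L \<le> card R" using K(5) by simp
  \<comment> \<open>In this product form it is evident that \<open>Q\<close> is at least -1, and
    that a positive \<open>Q\<close> forces \<open>card L\<close> to be at least 2.\<close>
  show "Q = (int (card L) - 1) * (int (card R) - 1) - 1"
    by (simp add: K(6) gain_def algebra_simps)
qed

text \<open>The threshold only rises during the scan, so a later winner also beats the initial
  \<open>best\<close>. The alternative \<open>cand = Some w\<close> covers the candidate already
  held, as the induction requires.\<close>

lemma scan_SomeD: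
  "scan q best cand ws = Some w \<Longrightarrow> cand = Some w \<or> w \<in> set ws \<and> q w > best"
proof (induction ws arbitrary: best cand)
  case (Cons a ws)
  show ?case
  proof (cases "q a > best")
    case True
    then show ?thesis using Cons.IH[of "q a" "Some a"] Cons.prems by auto
  next
    case False
    then show ?thesis using Cons.IH[of best cand] Cons.prems by auto
  qed
qed simp

text \<open>A candidate once set is never dropped, so the result \<open>None\<close> means that the
  threshold stayed at \<open>best\<close> throughout.\<close>

lemma scan_NoneD:
  "scan q best cand ws = None \<Longrightarrow> cand = None \<and> (\<forall>w\<in>set ws. q w \<le> best)"
proof (induction ws arbitrary: best cand)
  case (Cons a ws)
  show ?case
  proof (cases "q a > best")
    case True
    then show ?thesis using Cons.IH[of "q a" "Some a"] Cons.prems by simp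
  next
    case False
    then show ?thesis using Cons.IH[of best cand] Cons.prems by simp
  qed
qed simp

text \<open>A variable negated in a block of size k has k - 1 neighbours, and every block has a
  negated variable. Hence maximising the neighbourhood selects a largest block.\<close>

lemma choose_loop_block:
  assumes "blocks \<K> \<phi>" "v \<in> vars \<phi>" "\<forall>u\<in>vars \<phi>. card (nbrs \<phi> u) \<le> card (nbrs \<phi> v)"
  shows "\<exists>K. loop_block \<K> K {v} (nbrs \<phi> v) (gain (card {v}) (card (nbrs \<phi> v)))"
proof -
  have large: "card K' - 1 \<le> card (nbrs \<phi> v)" if K': "K' \<in> \<K>" for K'
  proof -
    have k: "finite K'" "3 \<le> card K'" using assms(1) K' by (auto simp: blocks_def)
    then obtain u where u: "Neg u \<in> K'"
      using block_has_Neg[OF assms(1) K', of "{}"] by auto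
    then have "u \<in> vars \<phi>"
      using K' by (force simp: vars_blocks[OF assms(1)])
    then have "card (nbrs \<phi> u) \<le> card (nbrs \<phi> v)" using assms(3) by blast
    then show ?thesis using nbrs_eq[OF assms(1) K' u] u k by simp
  qed
  obtain K' where K': "K' \<in> \<K>" using assms(1) by (auto simp: blocks_def)
  \<comment> \<open>This excludes that \<open>v\<close> occurs only positively and so places
    \<open>Neg v\<close> in a block.\<close>
  then have "card (nbrs \<phi> v) \<noteq> 0"
    using large[OF K'] assms(1) by (force simp: blocks_def)
  then obtain l where "l \<in> nbrs \<phi> v" by fastforce
  then obtain K where K: "K \<in> \<K>" "Neg v \<in> K"
    by (auto simp: in_nbrs_iff[OF assms(1)])
  have N: "nbrs \<phi> v = K - {Neg v}" using nbrs_eq[OF assms(1) K] .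
  have k: "finite K" "3 \<le> card K" using assms(1) K by (auto simp: blocks_def)
  have "card K' \<le> card K" if "K' \<in> \<K>" for K'
    using large[OF that] N K(2) k by simp
  then show ?thesis
    using K N k by (auto simp: loop_block_def)
qed

text \<open>A variable not negated in \<open>K\<close> has no neighbour in \<open>R\<close>, so its
  value is \<open>- (card L + 1)\<close>, below -1 and hence below \<open>Q\<close>. A winning
  \<open>w\<close> therefore moves one literal of \<open>K\<close> from \<open>R\<close> to the
  other side.\<close>

lemma extend_loop_block:
  assumes B: "blocks \<K> \<phi>" and LB: "loop_block \<K> K L R Q"
    and w: "w \<notin> L" "gain (card L + 1) (card (R \<inter> nbrs \<phi> w)) > Q"
  shows "loop_block \<K> K (insert w L) (R \<inter> nbrs \<phi> w) (gain (card L + 1) (card (R \<inter> nbrs \<phi> w)))"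
    and "card (R \<inter> nbrs \<phi> w) < card R"
proof -
  note c = loop_block_cards[OF B LB]
  have K: "K \<in> \<K>" "\<forall>K'\<in>\<K>. card K' \<le> card K" "Neg ` L \<subseteq> K" "R = K - Neg ` L"
    using LB unfolding loop_block_def by blast+
  have "Q \<ge> -1"
  proof -
    have "0 \<le> (int (card L) - 1) * (int (card R) - 1)"
      using c(2,6) by (intro mult_nonneg_nonneg) auto
    then show ?thesis using c(7) by simp
  qed
  have "R \<inter> nbrs \<phi> w \<noteq> {}"
  proof
    assume "R \<inter> nbrs \<phi> w = {}"
    then have "gain (card L + 1) (card (R \<inter> nbrs \<phi> w)) < -1"
      using c(2) by (simp add: gain_def)
    then show False using w(2) \<open>Q \<ge> -1\<close> by simp
  qed
  then obtain l where "l \<in> R" "l \<in> nbrs \<phi> w" by auto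
  then obtain K' where "K' \<in> \<K>" "Neg w \<in> K'" "l \<in> K'" "l \<in> K"
    using K(4) by (auto simp: in_nbrs_iff[OF B])
  then have wK: "Neg w \<in> K"
    using blocks_unique[OF B, of K' K l] K(1) by simp
  have N: "R \<inter> nbrs \<phi> w = K - Neg ` insert w L"
    using nbrs_eq[OF B K(1) wK] K(4) by auto
  have "R \<inter> nbrs \<phi> w = R - {Neg w}" "Neg w \<in> R"
    using N K(4) wK w(1) by auto
  moreover have "finite R" using c(3) K(4) by simp
  ultimately have card: "card R = Suc (card (R \<inter> nbrs \<phi> w))"
    by (metis card_Suc_Diff1)
  then show "card (R \<inter> nbrs \<phi> w) < card R" by simp
  \<comment> \<open>These are the new and the old gain, each plus 1. They differ by
    \<open>card R - card L - 1\<close>, so the gain grows only if \<open>L\<close> stays within half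
    of \<open>K\<close>.\<close>
  have "int (card L) * (int (card R) - 2) > (int (card L) - 1) * (int (card R) - 1)"
    using w(2) unfolding c(7) card by (simp add: gain_def algebra_simps)
  then have "card L + 1 < card R" by (simp add: algebra_simps)
  then show "loop_block \<K> K (insert w L) (R \<inter> nbrs \<phi> w) (gain (card L + 1) (card (R \<inter> nbrs \<phi> w)))"
    using K N wK c w(1) by (simp add: loop_block_def)
qed

text \<open>If \<open>card R\<close> were at least \<open>card L + 2\<close>, some negative literal
  of \<open>K\<close> would remain in \<open>R\<close>, and moving it would raise the gain by
  \<open>card R - card L - 1\<close>, which is positive.\<close>

lemma balanced_at_exit:
  assumes B: "blocks \<K> \<phi>" and LB: "loop_block \<K> K L R Q"
    and exit: "\<forall>w\<in>vars \<phi> - L. gain (card L + 1) (card (R \<inter> nbrs \<phi> w)) \<le> Q"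
  shows "card R \<le> card L + 1"
proof (rule ccontr)
  assume unbalanced: "\<not> card R \<le> card L + 1"
  note c = loop_block_cards[OF B LB]
  have K: "K \<in> \<K>" "Neg ` L \<subseteq> K" "R = K - Neg ` L"
    using LB unfolding loop_block_def by blast+
  obtain w where w: "w \<notin> L" "Neg w \<in> K"
    using block_has_Neg[OF B K(1,2)] c unbalanced by auto
  have "w \<in> vars \<phi>" using w(2) K(1) by (force simp: vars_blocks[OF B])
  with exit w(1) have le: "gain (card L + 1) (card (R \<inter> nbrs \<phi> w)) \<le> Q" by blast
  have "R \<inter> nbrs \<phi> w = R - {Neg w}" "Neg w \<in> R"
    using nbrs_eq[OF B K(1) w(2)] K(3) w by auto
  moreover have "finite R" using c(3) K(3) by simp
  ultimately have card: "card R = Suc (card (R \<inter> nbrs \<phi> w))"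
    by (metis card_Suc_Diff1)
  have "int (card L) * (int (card R) - 2) \<le> (int (card L) - 1) * (int (card R) - 1)"
    using le unfolding c(7) card by (simp add: gain_def algebra_simps)
  then show False using unbalanced by (simp add: algebra_simps)
qed

text \<open>It is enough to bound the size of \<open>K\<close>, since no block is larger.\<close>

lemma stop_card:
  assumes B: "blocks \<K> \<phi>" and LB: "loop_block \<K> K L R Q"
    and exit: "\<forall>w\<in>vars \<phi> - L. gain (card L + 1) (card (R \<inter> nbrs \<phi> w)) \<le> Q"
    and "Q \<le> 0"
  shows "card \<phi> = 3 * excess \<K>"
proof -
  note c = loop_block_cards[OF B LB]
  have bal: "card R \<le> card L + 1" using balanced_at_exit[OF B LB exit] .
  have "card K \<le> 4"
  proof (rule ccontr)
    assume "\<not> card K \<le> 4"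
    \<comment> \<open>A nearly even cut of at least 5 literals has sides of at least 2 and 3, which
      already gives \<open>Q\<close> at least 1 * 2 - 1.\<close>
    then have "card L \<ge> 2" "card R \<ge> 3" using bal c by linarith+
    then have "(int (card L) - 1) * (int (card R) - 1) \<ge> 1 * 2"
      by (intro mult_mono) auto
    then show False using \<open>Q \<le> 0\<close> c(7) by simp
  qed
  have "card K' choose 2 = 3 * (card K' - 2)" if "K' \<in> \<K>" for K'
  proof -
    have "card K' \<le> 4" "3 \<le> card K'"
      using that B LB \<open>card K \<le> 4\<close> by (auto simp: blocks_def loop_block_def)
    then have "card K' = 3 \<or> card K' = 4" by auto
    then show ?thesis by (auto simp: choose_two)
  qed
  then show ?thesis
    by (simp add: card_blocks[OF B] excess_def sum_distrib_left)
qed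

section \<open>The replacement step\<close>

lemma products_eq:
  "clause_products {{Neg v} | v. v \<in> L} {{l} | l. l \<in> R} = {{a, b} | a b. a \<in> Neg ` L \<and> b \<in> R}"
proof (intro equalityI subsetI)
  fix c assume "c \<in> {{a, b} | a b. a \<in> Neg ` L \<and> b \<in> R}"
  then obtain v b where "c = {Neg v} \<union> {b}" "v \<in> L" "b \<in> R" by auto
  then show "c \<in> clause_products {{Neg v} | v. v \<in> L} {{l} | l. l \<in> R}"
    unfolding clause_products_def by blast
qed (auto simp: clause_products_def)

text \<open>The \<open>card L * card R\<close> clauses across the cut give way to
  \<open>card L + card R\<close> new ones, so the number of clauses falls by \<open>Q\<close>. Each
  side of the cut, with its literal of \<open>y\<close>, becomes a block.\<close>

lemma replace_blocks:
  assumes B: "blocks \<K> \<phi>" and LB: "loop_block \<K> K L R Q" and "Q > 0"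
    and bva: "bva_step {{Neg v} | v. v \<in> L} {{l} | l. l \<in> R} y \<phi> \<psi>"
  shows "\<exists>\<K>'. blocks \<K>' \<psi> \<and> excess \<K>' = excess \<K>" and "card \<psi> < card \<phi>"
proof -
  note c = loop_block_cards[OF B LB]
  have K: "K \<in> \<K>" "Neg ` L \<subseteq> K" "R = K - Neg ` L"
    using LB unfolding loop_block_def by blast+
  have fin: "finite \<K>" and dis: "disjoint \<K>" and \<phi>: "\<phi> = (\<Union>K\<in>\<K>. clique K)"
    using B by (auto simp: blocks_def)
  define A where "A = insert (Pos y) (Neg ` L)"
  define D where "D = insert (Neg y) R"
  define \<K>' where "\<K>' = insert A (insert D (\<K> - {K}))"
  have "y \<notin> vars \<phi>"
    using bva unfolding bva_step_def vars_def by blast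
  then have fresh: "Pos y \<notin> K'" "Neg y \<notin> K'" if "K' \<in> \<K>" for K'
    using that by (force simp: vars_blocks[OF B])+
  have fresh': "Pos y \<notin> Neg ` L" "Neg y \<notin> R"
    using fresh[OF K(1)] K by auto
  \<comment> \<open>With the literal of \<open>y\<close> added, both new blocks then have size at
    least 3, because \<open>R\<close> is at least as large as \<open>L\<close>.\<close>
  have cl: "card L \<ge> 2"
  proof (rule ccontr)
    assume "\<not> card L \<ge> 2"
    then have "card L = 1" using c(2) by simp
    then show False using c(7) \<open>Q > 0\<close> by simp
  qed
  have finR: "finite R" using c(3) K(3) by simp
  have cA: "card A = card L + 1" "finite A"
    using fresh' c(1) by (auto simp: A_def card_image inj_on_def)
  have cD: "card D = card R + 1" "finite D"
    using fresh' finR by (auto simp: D_def)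
  have new: "A \<inter> K' = {}" "D \<inter> K' = {}" if "K' \<in> \<K> - {K}" for K'
    using that fresh[of K'] disjointD[OF dis K(1), of K'] K(2,3) by (auto simp: A_def D_def)
  have AD: "A \<inter> D = {}"
    using fresh[OF K(1)] K by (auto simp: A_def D_def)
  have ne: "A \<noteq> {}" "D \<noteq> {}" by (auto simp: A_def D_def)
  \<comment> \<open>A nonempty set is not disjoint from itself. So the two new blocks differ from
    each other and from the old ones, and sums over \<open>\<K>'\<close> count each once.\<close>
  have notin: "A \<notin> insert D (\<K> - {K})" "D \<notin> \<K> - {K}"
    using new[of A] new[of D] AD ne by auto
  let ?P = "{{a, b} | a b. a \<in> Neg ` L \<and> b \<in> R}"
  have KLR: "K = Neg ` L \<union> R" "Neg ` L \<inter> R = {}" using K by auto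
  have PK: "?P \<subseteq> clique K"
    using cut_subset_clique[OF K(2)] K(3) by simp
  \<comment> \<open>The deleted clauses all come from \<open>K\<close>; the other blocks stay
    intact.\<close>
  have rest: "clique K' \<inter> ?P = {}" if "K' \<in> \<K> - {K}" for K'
    using that PK clique_disjoint[of K K'] disjointD[OF dis K(1), of K'] by blast
  have "\<phi> - ?P = (clique K - ?P) \<union> (\<Union>K'\<in>\<K> - {K}. clique K')"
    using K(1) rest unfolding \<phi> by blast
  also have "clique K - ?P = clique (Neg ` L) \<union> clique R"
    using clique_Un[OF KLR(2)] KLR(1) by simp
  finally have \<phi>P: "\<phi> - ?P = clique (Neg ` L) \<union> clique R \<union> (\<Union>K'\<in>\<K> - {K}. clique K')" .
  have "\<psi> = (\<phi> - ?P) \<union> {C \<union> {Pos y} | C. C \<in> {{Neg v} | v. v \<in> L}}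
      \<union> {{Neg y} \<union> D | D. D \<in> {{l} | l. l \<in> R}}"
    using bva by (simp add: bva_step_def products_eq)
  also have "{C \<union> {Pos y} | C. C \<in> {{Neg v} | v. v \<in> L}} = {{Pos y, b} | b. b \<in> Neg ` L}"
    by (auto simp: insert_commute)
  also have "{{Neg y} \<union> D | D. D \<in> {{l} | l. l \<in> R}} = {{Neg y, b} | b. b \<in> R}"
    by auto
  finally have \<psi>: "\<psi> = (\<Union>K'\<in>\<K>'. clique K')"
    unfolding \<phi>P \<K>'_def
    by (auto simp: A_def D_def clique_insert[OF fresh'(1)] clique_insert[OF fresh'(2)])
  have "disjoint \<K>'"
    unfolding \<K>'_def using new AD dis
    by (auto simp: pairwise_insert disjnt_def Int_commute intro: pairwise_subset)
  moreover have "\<forall>u v. Pos u \<in> A \<longrightarrow> Pos v \<in> A \<longrightarrow> u = v"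
    by (auto simp: A_def)
  moreover have "\<forall>u v. Pos u \<in> D \<longrightarrow> Pos v \<in> D \<longrightarrow> u = v"
    using B K by (auto simp: D_def blocks_def)
  ultimately have B': "blocks \<K>' \<psi>"
    using B cA cD cl c \<psi> unfolding blocks_def by (auto simp: \<K>'_def)
  have sum': "sum f \<K>' = f A + f D + sum f (\<K> - {K})" for f :: "'a literal set \<Rightarrow> nat"
    using notin fin by (simp add: \<K>'_def)
  have sum: "sum f \<K> = f K + sum f (\<K> - {K})" for f :: "'a literal set \<Rightarrow> nat"
    using K(1) fin by (rule sum.remove[rotated])
  \<comment> \<open>The new blocks contribute \<open>card L - 1\<close> and
    \<open>card R - 1\<close>, together \<open>card K - 2\<close>.\<close>
  have "excess \<K>' = excess \<K>"
    unfolding excess_def sum sum' using cA cD c cl by simp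
  with B' show "\<exists>\<K>'. blocks \<K>' \<psi> \<and> excess \<K>' = excess \<K>" by blast
  \<comment> \<open>Passing to predecessors turns \<open>Q > 0\<close> into \<open>l * r > 1\<close>
    over the naturals.\<close>
  obtain l r where lr: "card L = Suc l" "card R = Suc r"
    using c(2,6) by (metis Suc_le_D One_nat_def le_trans)
  have "int l * int r > 1"
    using c(7) \<open>Q > 0\<close> lr by simp
  then have "l * r > 1" by (metis of_nat_1 of_nat_less_iff of_nat_mult)
  \<comment> \<open>Doubling avoids the division in the binomial coefficients; the two doubled sides
    below then differ by \<open>2 * l * r - 2\<close>.\<close>
  have tri: "2 * (m choose 2) = m * (m - 1)" for m :: nat
    using dvd_mult_div_cancel[of 2 "m * (m - 1)"] by (cases m) (auto simp: choose_two)
  have "2 * ((card A choose 2) + (card D choose 2)) < 2 * (card K choose 2)"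
    unfolding distrib_left tri cA cD c(5)[symmetric] lr
    using \<open>l * r > 1\<close> by (simp add: algebra_simps)
  then show "card \<psi> < card \<phi>"
    unfolding card_blocks[OF B] card_blocks[OF B'] sum sum' by simp
qed

section \<open>Preservation of the invariant and termination\<close>

fun state_formula :: "'v state \<Rightarrow> 'v formula" where
  "state_formula (Choose \<phi>) = \<phi>"
| "state_formula (Loop \<phi> L R Q) = \<phi>"
| "state_formula (Final \<phi>) = \<phi>"

fun state_phase :: "'v state \<Rightarrow> nat" where
  "state_phase (Choose \<phi>) = 2"
| "state_phase (Loop \<phi> L R Q) = 1"
| "state_phase (Final \<phi>) = 0"

fun state_width :: "'v state \<Rightarrow> nat" where
  "state_width (Loop \<phi> L R Q) = card R"
| "state_width _ = 0"

text \<open>Lexicographic: a replacement lowers the number of clauses, choosing and stopping keep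
  the formula but lower the phase, and extending keeps both but shrinks \<open>R\<close>.\<close>

definition state_order :: "('v state \<times> 'v state) set" where
  "state_order = measures [card \<circ> state_formula, state_phase, state_width]"

text \<open>Descent is proved together with the invariant because it depends on it: the block
  structure is what makes \<open>R\<close> shrink and the clauses decrease.\<close>

lemma step_preserves:
  assumes "heuristic_step s t" and "state_inv m s"
  shows "state_inv m t \<and> (t, s) \<in> state_order"
  using assms
proof cases
  case (choose v \<phi> L R)
  with assms(2) obtain \<K> where B: "blocks \<K> \<phi>" "excess \<K> = m"
    by auto
  show ?thesis
    using choose_loop_block[OF B(1) choose(3,4)] B choose(1,2,5,6) by (auto simp: state_order_def)
next
  case (extend \<phi> L ws R Q w Rw)
  with assms(2) obtain \<K> K where B: "blocks \<K> \<phi>" "excess \<K> = m" "loop_block \<K> K L R Q"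
    by auto
  have "w \<notin> L" "gain (card L + 1) (card (R \<inter> nbrs \<phi> w)) > Q"
    using scan_SomeD[OF extend(4)[unfolded scan_result_def]] extend(3)
    by (auto simp: iteration_order_def)
  note extend_loop_block[OF B(1,3) this]
  then show ?thesis
    using B(1,2) extend(1,2,5) by (auto simp: state_order_def)
next
  case (replace \<phi> L ws R Q y \<psi>)
  with assms(2) obtain \<K> K where B: "blocks \<K> \<phi>" "excess \<K> = m" "loop_block \<K> K L R Q"
    by auto
  show ?thesis
    using replace_blocks[OF B(1,3) replace(5,6)] B(2) replace(1,2) by (auto simp: state_order_def)
next
  case (stop \<phi> L ws R Q)
  with assms(2) obtain \<K> K where B: "blocks \<K> \<phi>" "excess \<K> = m" "loop_block \<K> K L R Q"
    by auto
  have "\<forall>w\<in>vars \<phi> - L. gain (card L + 1) (card (R \<inter> nbrs \<phi> w)) \<le> Q"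
    using scan_NoneD[OF stop(4)[unfolded scan_result_def]] stop(3)
    by (auto simp: iteration_order_def)
  then show ?thesis
    using stop_card[OF B(1,3) _ stop(5)] B(2) stop(1,2) by (auto simp: state_order_def)
qed

section \<open>Existence of successor states\<close>

lemma progress_Choose:
  assumes "blocks \<K> \<phi>"
  shows "\<exists>t. heuristic_step (Choose \<phi>) t"
proof -
  obtain K where "K \<in> \<K>" "K \<noteq> {}"
    using assms by (fastforce simp: blocks_def)
  then have "vars \<phi> \<noteq> {}" by (auto simp: vars_blocks[OF assms])
  then have "Max ((\<lambda>u. card (nbrs \<phi> u)) ` vars \<phi>) \<in> (\<lambda>u. card (nbrs \<phi> u)) ` vars \<phi>"
    using finite_blocks(2)[OF assms] by (intro Max_in) auto
  then obtain v where v: "v \<in> vars \<phi>" "Max ((\<lambda>u. card (nbrs \<phi> u)) ` vars \<phi>) = card (nbrs \<phi> v)"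
    by auto
  then have "\<forall>u\<in>vars \<phi>. card (nbrs \<phi> u) \<le> card (nbrs \<phi> v)"
    using finite_blocks(2)[OF assms] by (metis Max_ge finite_imageI imageI)
  from heuristic_step.choose[OF v(1) this refl refl] show ?thesis ..
qed

lemma progress_Loop:
  assumes "infinite (UNIV :: 'v set)"
    and B: "blocks \<K> \<phi>" and LB: "loop_block \<K> K L R Q"
  shows "\<exists>t. heuristic_step (Loop \<phi> L (R :: 'v literal set) Q) t"
proof -
  have K: "K \<in> \<K>" "Neg ` L \<subseteq> K" "R = K - Neg ` L"
    using LB unfolding loop_block_def by blast+
  obtain ws where ws: "iteration_order \<phi> L ws"
    using finite_distinct_list[of "vars \<phi> - L"] finite_blocks(2)[OF B]
    by (auto simp: iteration_order_def)
  show ?thesis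
  proof (cases "scan_result \<phi> L R Q ws")
    case (Some w)
    from heuristic_step.extend[OF ws this refl] show ?thesis ..
  next
    case None
    show ?thesis
    proof (cases "Q > 0")
      case False
      then have "Q \<le> 0" by simp
      from heuristic_step.stop[OF ws None this] show ?thesis ..
    next
      case True
      obtain y where y: "y \<notin> vars \<phi>"
        using assms(1) finite_blocks(2)[OF B] by (metis ex_new_if_finite)
      have sub: "var ` K \<subseteq> vars \<phi>" using K(1) by (auto simp: vars_blocks[OF B])
      \<comment> \<open>All variables of \<open>L\<close> and \<open>R\<close> already occur in
        \<open>\<phi>\<close>, so avoiding \<open>vars \<phi>\<close> is enough for
        freshness.\<close>
      have "L \<subseteq> var ` K" using K(2) by force
      moreover have "vars (\<phi> \<union> {{Neg v} | v. v \<in> L} \<union> {{l} | l. l \<in> R}) = vars \<phi> \<union> L \<union> var ` R"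
        by (simp add: vars_def setcompr_eq_image UNION_singleton_eq_range)
      ultimately have fresh: "y \<notin> vars (\<phi> \<union> {{Neg v} | v. v \<in> L} \<union> {{l} | l. l \<in> R})"
        using sub y K(3) by blast
      have "{{a, b} | a b. a \<in> Neg ` L \<and> b \<in> R} \<subseteq> clique K"
        using cut_subset_clique[OF K(2)] K(3) by simp
      moreover have "clique K \<subseteq> \<phi>"
        using B K(1) by (auto simp: blocks_def)
      ultimately have "clause_products {{Neg v} | v. v \<in> L} {{l} | l. l \<in> R} \<subseteq> \<phi>"
        unfolding products_eq by (rule order_trans)
      with fresh have "\<exists>\<psi>. bva_step {{Neg v} | v. v \<in> L} {{l} | l. l \<in> R} y \<phi> \<psi>"
        by (auto simp: bva_step_def non_complementary_def)
      then obtain \<psi> where "bva_step {{Neg v} | v. v \<in> L} {{l} | l. l \<in> R} y \<phi> \<psi>" ..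
      from heuristic_step.replace[OF ws None True this] show ?thesis ..
    qed
  qed
qed

theorem theorem46:
  fixes n :: nat and x :: "nat \<Rightarrow> 'v"
  assumes "n \<ge> 3"
    and "inj_on x {1..n}"
    and "infinite (UNIV :: 'v set)"
  shows "(\<nexists>s. s 0 = Choose (at_most_one n x) \<and> (\<forall>i. heuristic_step (s i) (s (Suc i)))) \<and>
    (\<forall>t. heuristic_step\<^sup>*\<^sup>* (Choose (at_most_one n x)) t \<and> (\<nexists>t'. heuristic_step t t') \<longrightarrow>
       (\<exists>\<psi>. t = Final \<psi> \<and> card \<psi> = 3 * n - 6))"
proof (intro conjI allI impI notI)
  have init: "state_inv (n - 2) (Choose (at_most_one n x))"
    using blocks_at_most_one[OF assms(1,2)] by auto
  {
    assume "\<exists>s. s 0 = Choose (at_most_one n x) \<and> (\<forall>i. heuristic_step (s i) (s (Suc i)))"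
    then obtain s where s: "s 0 = Choose (at_most_one n x)" "\<And>i. heuristic_step (s i) (s (Suc i))"
      by blast
    have "state_inv (n - 2) (s i)" for i
    proof (induction i)
      case (Suc i)
      then show ?case using step_preserves[OF s(2)] by blast
    qed (simp only: s(1) init)
    \<comment> \<open>An infinite run would be an infinite descending chain in a well-founded
      order.\<close>
    then have "(s (Suc i), s i) \<in> state_order" for i
      using s(2) step_preserves by blast
    moreover have "wf (state_order :: ('v state \<times> 'v state) set)"
      by (simp add: state_order_def)
    ultimately show False
      by (auto simp: wf_iff_no_infinite_down_chain)
  }
  fix t
  assume t: "heuristic_step\<^sup>*\<^sup>* (Choose (at_most_one n x)) t \<and> (\<nexists>t'. heuristic_step t t')"
  then have "heuristic_step\<^sup>*\<^sup>* (Choose (at_most_one n x)) t" by blast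
  then have "state_inv (n - 2) t"
    by (induction rule: rtranclp_induct) (use init step_preserves in blast)+
  \<comment> \<open>Under the invariant the states \<open>Choose\<close> and \<open>Loop\<close>
    always have a successor, so a stuck state is \<open>Final\<close>, with 3 (n - 2)
    clauses.\<close>
  then show "\<exists>\<psi>. t = Final \<psi> \<and> card \<psi> = 3 * n - 6"
  proof (cases t)
    case (Choose \<phi>)
    with \<open>state_inv (n - 2) t\<close> t show ?thesis using progress_Choose by auto
  next
    case (Loop \<phi> L R Q)
    with \<open>state_inv (n - 2) t\<close> obtain \<K> K where "blocks \<K> \<phi>" "loop_block \<K> K L R Q"
      by auto
    with Loop t show ?thesis using progress_Loop[OF assms(3)] by blast
  next
    case (Final \<phi>)
    with \<open>state_inv (n - 2) t\<close> show ?thesis by auto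
  qed
qed

end
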